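(* Let $S$ be a commutative Noetherian local ring, let $g\in S$, and let $R=S\llbracket z\rrbracket/(z^2+g)$. Let $\varphi$ be an $n\times n$ matrix over $S\llbracket z\rrbracket$ whose entries lie in $S$ such that $(z\,\mathrm{Id}_n-\varphi,\ z\,\mathrm{Id}_n+\varphi)$ is a matrix factorization for $z^2+g$ in $S\llbracket z\rrbracket$. If $M=\operatorname{coker}(\overline{z\,\mathrm{Id}_n-\varphi})$, then the trace ideal of $M$ is generated by the entries of $\overline{z\,\mathrm{Id}_n+\varphi}$.
   Context: A matrix factorization for an element $x$ of a ring $A$ is a pair of maps of free $A$-modules $(\alpha:F\to G,\ \beta:G\to F)$ such that $\alpha\beta=x\cdot 1_G$ and $\beta\alpha=x\cdot 1_F$. An $n\times n$ matrix is regarded as a linear map between free modules of rank $n$. For a matrix $\Phi$ over $S\llbracket z\rrbracket$, $\overline{\Phi}$ denotes the same matrix over the quotient ring $R=S\llbracket z\rrbracket/(z^2+g)$. $\mathrm{Id}_n$ is the $n\times n$ identity matrix. The trace ideal of an $R$-module $M$ is $\operatorname{tr}_M(R)=\sum_{f\in\operatorname{Hom}_R(M,R)}f(M)\subseteq R$. *)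

theory Defs
  imports
    "HOL-Algebra.QuotRing"
    "HOL-Algebra.Ring_Divisibility"
    "HOL-Computational_Algebra.Formal_Power_Series"
    "Jordan_Normal_Form.VS_Connect"
begin

definition local_ring :: "('a, 'b) ring_scheme \<Rightarrow> bool" where
  "local_ring A \<longleftrightarrow> cring A \<and> (\<exists>!\<mm>. maximalideal \<mm> A)"

abbreviation free_space :: "('a, 'b) ring_scheme \<Rightarrow> nat \<Rightarrow> ('a, nat \<Rightarrow> 'a) module" where
  "free_space A n \<equiv> LinearCombinations.ring.func_space A {..<n}"

definition free_module :: "('a, 'b) ring_scheme \<Rightarrow> ('a, 'c, 'd) module_scheme \<Rightarrow> bool" where
  "free_module A F \<longleftrightarrow> Module.module A F \<and>
    (\<exists>B \<subseteq> carrier F. \<not> LinearCombinations.module.lin_dep A F B \<and>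
       LinearCombinations.module.span A F B = carrier F)"

text \<open>Matrices act on column vectors, that is, on extensional functions on \<open>{..<n}\<close>.\<close>

definition matrix_map :: "('a, 'b) ring_scheme \<Rightarrow> 'a mat \<Rightarrow> (nat \<Rightarrow> 'a) \<Rightarrow> (nat \<Rightarrow> 'a)" where
  "matrix_map A \<Phi> =
    (\<lambda>v. \<lambda>i\<in>{..<dim_row \<Phi>}. \<Oplus>\<^bsub>A\<^esub> j\<in>{..<dim_col \<Phi>}. \<Phi> $$ (i, j) \<otimes>\<^bsub>A\<^esub> v j)"

definition matrix_factorization ::
  "('a, 'b) ring_scheme \<Rightarrow> 'a \<Rightarrow> ('a, 'c, 'd) module_scheme \<Rightarrow> ('a, 'e, 'f) module_scheme \<Rightarrow>
    ('c \<Rightarrow> 'e) \<Rightarrow> ('e \<Rightarrow> 'c) \<Rightarrow> bool" where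
  "matrix_factorization A x F G \<alpha> \<beta> \<longleftrightarrow>
    free_module A F \<and> free_module A G \<and>
    \<alpha> \<in> module_hom A F G \<and> \<beta> \<in> module_hom A G F \<and>
    (\<forall>v\<in>carrier G. \<alpha> (\<beta> v) = x \<odot>\<^bsub>G\<^esub> v) \<and>
    (\<forall>v\<in>carrier F. \<beta> (\<alpha> v) = x \<odot>\<^bsub>F\<^esub> v)"

text \<open>The fields \<open>mult\<close> and \<open>one\<close> of a module record carry no meaning. When \<open>N\<close> is a submodule, the
  union in \<open>smult\<close> is over equal cosets.\<close>

definition quotient_module ::
  "('a, 'c, 'd) module_scheme \<Rightarrow> 'c set \<Rightarrow> ('a, 'c set) module" where
  "quotient_module M N = \<lparr>
     carrier = a_rcosets\<^bsub>M\<^esub> N, mult = undefined, one = undefined,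
     zero = N, add = set_add M,
     smult = (\<lambda>a X. \<Union>x\<in>X. N +>\<^bsub>M\<^esub> (a \<odot>\<^bsub>M\<^esub> x))\<rparr>"

definition cokernel ::
  "('a, 'c, 'd) module_scheme \<Rightarrow> ('a, 'e, 'f) module_scheme \<Rightarrow> ('c \<Rightarrow> 'e) \<Rightarrow> ('a, 'e set) module"
  where "cokernel F G f = quotient_module G (f ` carrier F)"

definition regular_module :: "('a, 'b) ring_scheme \<Rightarrow> ('a, 'a) module" where
  "regular_module A = \<lparr>carrier = carrier A, mult = mult A, one = one A,
     zero = zero A, add = add A, smult = mult A\<rparr>"

text \<open>The sum of the submodules \<open>f(M)\<close> is the set of all finite sums of their elements; the same
  \<open>f\<close> may be repeated.\<close>

definition trace_ideal :: "('a, 'b) ring_scheme \<Rightarrow> ('a, 'c, 'd) module_scheme \<Rightarrow> 'a set" where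
  "trace_ideal A M =
    {\<Oplus>\<^bsub>A\<^esub> i\<in>{..<k}. f i (m i) | (k::nat) f m.
       \<forall>i<k. f i \<in> module_hom A M (regular_module A) \<and> m i \<in> carrier M}"

text \<open>The base ring \<open>S\<close> is the type \<open>'a\<close>, and \<open>class_ring\<close> is the ring record of a type; \<open>fps_X\<close> is the
  variable \<open>z\<close>, and \<open>range fps_const\<close> is the copy of \<open>S\<close> inside \<open>S[[z]]\<close>.\<close>

abbreviation power_series_ring :: "'a::comm_ring_1 fps ring" where
  "power_series_ring \<equiv> class_ring"

definition hypersurface_ideal :: "'a::comm_ring_1 \<Rightarrow> 'a fps set" where
  "hypersurface_ideal g = PIdl\<^bsub>power_series_ring\<^esub> (fps_X ^ 2 + fps_const g)"

definition hypersurface_ring :: "'a::comm_ring_1 \<Rightarrow> 'a fps set ring" where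
  "hypersurface_ring g = power_series_ring Quot hypersurface_ideal g"

definition reduce_mat :: "'a::comm_ring_1 \<Rightarrow> 'a fps mat \<Rightarrow> 'a fps set mat" where
  "reduce_mat g \<Phi> = map_mat (\<lambda>a. hypersurface_ideal g +>\<^bsub>power_series_ring\<^esub> a) \<Phi>"

text \<open>Consistency checks: the free modules and the quotient are modules, the matrix factorization
  hypothesis is the expected pair of matrix identities, and the trace ideal is the ideal generated by
  the images of all homomorphisms.\<close>

lemma free_space_carrier: "ring A \<Longrightarrow> carrier (free_space A n) = {..<n} \<rightarrow>\<^sub>E carrier A"
  and free_space_add: "ring A \<Longrightarrow> add (free_space A n) = (\<lambda>f g. \<lambda>i\<in>{..<n}. f i \<oplus>\<^bsub>A\<^esub> g i)"
  and free_space_smult: "ring A \<Longrightarrow> smult (free_space A n) = (\<lambda>c f. \<lambda>i\<in>{..<n}. c \<otimes>\<^bsub>A\<^esub> f i)"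
  and free_space_zero: "ring A \<Longrightarrow> zero (free_space A n) = (\<lambda>i\<in>{..<n}. \<zero>\<^bsub>A\<^esub>)"
  by (simp_all add: LinearCombinations.ring.func_space_def)

lemma free_space_finsum:
  assumes "cring A" "finite I" "\<And>k. k \<in> I \<Longrightarrow> f k \<in> {..<n} \<rightarrow>\<^sub>E carrier A"
  shows "finsum (free_space A n) f I = (\<lambda>i\<in>{..<n}. \<Oplus>\<^bsub>A\<^esub> k\<in>I. f k i)"
  using assms(2,3)
proof (induction I rule: finite_induct)
  interpret A: cring A by fact
  interpret F: Module.module A "free_space A n" by (rule A.func_space_is_module)
  { case empty show ?case by (simp add: free_space_zero[OF A.ring_axioms]) }
  { case (insert x I)
    have fx: "f x \<in> {..<n} \<rightarrow>\<^sub>E carrier A" and fI: "\<And>k. k \<in> I \<Longrightarrow> f k \<in> {..<n} \<rightarrow>\<^sub>E carrier A"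
      using insert.prems by auto
    have "finsum (free_space A n) f (insert x I) = f x \<oplus>\<^bsub>free_space A n\<^esub> finsum (free_space A n) f I"
      using insert fx fI by (intro F.M.finsum_insert) (auto simp: free_space_carrier[OF A.ring_axioms])
    also have "\<dots> = (\<lambda>i\<in>{..<n}. f x i \<oplus>\<^bsub>A\<^esub> (\<Oplus>\<^bsub>A\<^esub> k\<in>I. f k i))"
      using insert.IH[OF fI] unfolding free_space_add[OF A.ring_axioms] by (auto simp: fun_eq_iff restrict_def)
    also have "\<dots> = (\<lambda>i\<in>{..<n}. \<Oplus>\<^bsub>A\<^esub> k\<in>insert x I. f k i)"
    proof (rule restrict_ext)
      fix i assume i: "i \<in> {..<n}"
      show "f x i \<oplus>\<^bsub>A\<^esub> (\<Oplus>\<^bsub>A\<^esub> k\<in>I. f k i) = (\<Oplus>\<^bsub>A\<^esub> k\<in>insert x I. f k i)"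
        using insert.hyps fx fI i by (subst A.finsum_insert) (auto simp: PiE_iff)
    qed
    finally show ?case . }
qed

lemma free_module_free_space:
  assumes "cring A"
  shows "free_module A (free_space A n)"
proof (cases "\<one>\<^bsub>A\<^esub> = \<zero>\<^bsub>A\<^esub>")
  interpret A: cring A by fact
  interpret F: Module.module A "free_space A n" by (rule A.func_space_is_module)
  case True
  have c: "carrier A = {\<zero>\<^bsub>A\<^esub>}" using True A.one_zeroD by simp
  have cF: "carrier (free_space A n) = {\<zero>\<^bsub>free_space A n\<^esub>}"
    unfolding free_space_carrier[OF A.ring_axioms] free_space_zero[OF A.ring_axioms] c by (auto simp: PiE_def extensional_def fun_eq_iff)
  show ?thesis unfolding free_module_def
    by (intro conjI exI[of _ "{}"] F.module_axioms)
       (auto simp: F.lin_dep_def F.span_def F.lincomb_def cF)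
next
  interpret A: cring A by fact
  interpret F: Module.module A "free_space A n" by (rule A.func_space_is_module)
  case False
  define e where "e k = (\<lambda>i\<in>{..<n}. if i = k then \<one>\<^bsub>A\<^esub> else \<zero>\<^bsub>A\<^esub>)" for k
  have e: "e k \<in> {..<n} \<rightarrow>\<^sub>E carrier A" for k by (auto simp: e_def)
  have inj: "inj_on e {..<n}"
  proof (rule inj_onI)
    fix k l assume "k \<in> {..<n}" "l \<in> {..<n}" "e k = e l"
    then have "e k k = e l k" by simp
    then show "k = l" using False \<open>k \<in> {..<n}\<close> by (auto simp: e_def split: if_splits)
  qed
  have lc: "F.lincomb a (e ` {..<n}) = (\<lambda>i\<in>{..<n}. a (e i))" if a: "a \<in> e ` {..<n} \<rightarrow> carrier A" for a
  proof -
    have "F.lincomb a (e ` {..<n}) = finsum (free_space A n) (\<lambda>k. a (e k) \<odot>\<^bsub>free_space A n\<^esub> e k) {..<n}"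
      unfolding F.lincomb_def
    proof (rule F.M.finsum_reindex[OF _ inj])
      show "(\<lambda>v. a v \<odot>\<^bsub>free_space A n\<^esub> v) \<in> e ` {..<n} \<rightarrow> carrier (free_space A n)"
      proof
        fix w assume "w \<in> e ` {..<n}"
        then have "a w \<in> carrier A" "w \<in> carrier (free_space A n)"
          using a e by (auto simp: free_space_carrier[OF A.ring_axioms] simp del: PiE_iff)
        then show "a w \<odot>\<^bsub>free_space A n\<^esub> w \<in> carrier (free_space A n)" by (rule F.smult_closed)
      qed
    qed
    also have "\<dots> = (\<lambda>i\<in>{..<n}. \<Oplus>\<^bsub>A\<^esub> k\<in>{..<n}. (a (e k) \<odot>\<^bsub>free_space A n\<^esub> e k) i)"
    proof (intro free_space_finsum assms)
      fix k assume "k \<in> {..<n}"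
      then have "a (e k) \<in> carrier A" using a by auto
      with e[of k] show "a (e k) \<odot>\<^bsub>free_space A n\<^esub> e k \<in> {..<n} \<rightarrow>\<^sub>E carrier A"
        by (auto simp: free_space_smult[OF A.ring_axioms] PiE_iff)
    qed simp
    also have "\<dots> = (\<lambda>i\<in>{..<n}. a (e i))"
    proof (rule restrict_ext)
      fix i assume i: "i \<in> {..<n}"
      have "(\<Oplus>\<^bsub>A\<^esub> k\<in>{..<n}. (a (e k) \<odot>\<^bsub>free_space A n\<^esub> e k) i)
          = (\<Oplus>\<^bsub>A\<^esub> k\<in>{..<n}. if i = k then a (e k) else \<zero>\<^bsub>A\<^esub>)"
        using a i by (intro A.finsum_cong') (auto simp: free_space_smult[OF A.ring_axioms] e_def Pi_iff)
      also have "\<dots> = a (e i)" using a i by (intro A.finsum_singleton) auto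
      finally show "(\<Oplus>\<^bsub>A\<^esub> k\<in>{..<n}. (a (e k) \<odot>\<^bsub>free_space A n\<^esub> e k) i) = a (e i)" .
    qed
    finally show ?thesis .
  qed
  have sub: "e ` {..<n} \<subseteq> carrier (free_space A n)" using e by (auto simp: free_space_carrier[OF A.ring_axioms])
  have "\<not> F.lin_dep (e ` {..<n})"
  proof
    assume "F.lin_dep (e ` {..<n})"
    from F.finite_lin_dep[OF _ this sub] obtain a v where
      a: "a \<in> e ` {..<n} \<rightarrow> carrier A" "F.lincomb a (e ` {..<n}) = \<zero>\<^bsub>free_space A n\<^esub>"
        "v \<in> e ` {..<n}" "a v \<noteq> \<zero>\<^bsub>A\<^esub>" by auto
    then obtain i where i: "i < n" "v = e i" by auto
    have "(\<lambda>i\<in>{..<n}. a (e i)) = (\<lambda>i\<in>{..<n}. \<zero>\<^bsub>A\<^esub>)" using lc[OF a(1)] a(2) free_space_zero[OF A.ring_axioms] by simp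
    from fun_cong[OF this, of i] i a(4) show False by simp
  qed
  moreover have "F.span (e ` {..<n}) = carrier (free_space A n)"
  proof
    show "F.span (e ` {..<n}) \<subseteq> carrier (free_space A n)"
      using F.span_is_subset2[OF sub] .
    show "carrier (free_space A n) \<subseteq> F.span (e ` {..<n})"
    proof
      fix v assume v: "v \<in> carrier (free_space A n)"
      then have v': "v \<in> {..<n} \<rightarrow>\<^sub>E carrier A" by (simp add: free_space_carrier[OF A.ring_axioms])
      define a where "a w = v (the_inv_into {..<n} e w)" for w
      have ae: "a (e i) = v i" if "i < n" for i using that inj by (simp add: a_def the_inv_into_f_f)
      have a: "a \<in> e ` {..<n} \<rightarrow> carrier A" using v' ae by (auto simp: PiE_iff)
      have "F.lincomb a (e ` {..<n}) = v" unfolding lc[OF a]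
        using v' ae by (auto simp: fun_eq_iff restrict_def PiE_def extensional_def)
      then show "v \<in> F.span (e ` {..<n})" unfolding F.finite_span[OF finite_imageI[OF finite_lessThan] sub]
        using a by auto
    qed
  qed
  ultimately show ?thesis unfolding free_module_def using sub F.module_axioms by blast
qed

lemma matrix_map_module_hom:
  assumes "cring A" "\<Phi> \<in> carrier_mat m n" "\<And>i j. i < m \<Longrightarrow> j < n \<Longrightarrow> \<Phi> $$ (i, j) \<in> carrier A"
  shows "matrix_map A \<Phi> \<in> module_hom A (free_space A n) (free_space A m)"
proof -
  interpret A: cring A by fact
  note fs = free_space_carrier[OF A.ring_axioms] free_space_add[OF A.ring_axioms] free_space_smult[OF A.ring_axioms]
  have d: "dim_row \<Phi> = m" "dim_col \<Phi> = n" using assms(2) by auto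
  show ?thesis unfolding module_hom_def fs matrix_map_def d
  proof (safe, goal_cases)
    case 1 then show ?case using assms(3) by (auto simp: PiE_iff intro!: A.finsum_closed)
  next
    case 2 then show ?case by (auto simp: restrict_def split: if_splits)
  next
    case (3 u v)
    show ?case
    proof
      fix i
      show "(\<lambda>i\<in>{..<m}. \<Oplus>\<^bsub>A\<^esub>j\<in>{..<n}. \<Phi> $$ (i, j) \<otimes>\<^bsub>A\<^esub> (\<lambda>i\<in>{..<n}. u i \<oplus>\<^bsub>A\<^esub> v i) j) i =
        (\<lambda>i\<in>{..<m}. (\<lambda>i\<in>{..<m}. \<Oplus>\<^bsub>A\<^esub>j\<in>{..<n}. \<Phi> $$ (i, j) \<otimes>\<^bsub>A\<^esub> u j) i \<oplus>\<^bsub>A\<^esub>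
           (\<lambda>i\<in>{..<m}. \<Oplus>\<^bsub>A\<^esub>j\<in>{..<n}. \<Phi> $$ (i, j) \<otimes>\<^bsub>A\<^esub> v j) i) i"
      proof (cases "i < m")
        case True
        have "(\<Oplus>\<^bsub>A\<^esub>j\<in>{..<n}. \<Phi> $$ (i, j) \<otimes>\<^bsub>A\<^esub> (\<lambda>i\<in>{..<n}. u i \<oplus>\<^bsub>A\<^esub> v i) j) =
          (\<Oplus>\<^bsub>A\<^esub>j\<in>{..<n}. \<Phi> $$ (i, j) \<otimes>\<^bsub>A\<^esub> u j \<oplus>\<^bsub>A\<^esub> \<Phi> $$ (i, j) \<otimes>\<^bsub>A\<^esub> v j)"
        proof (rule A.finsum_cong')
          have *: "v j \<in> carrier A" "u j \<in> carrier A" "\<Phi> $$ (i, j) \<in> carrier A" if "j \<in> {..<n}" for j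
            using that 3 assms(3) True by auto
          show "\<Phi> $$ (i, j) \<otimes>\<^bsub>A\<^esub> (\<lambda>i\<in>{..<n}. u i \<oplus>\<^bsub>A\<^esub> v i) j = \<Phi> $$ (i, j) \<otimes>\<^bsub>A\<^esub> u j \<oplus>\<^bsub>A\<^esub> \<Phi> $$ (i, j) \<otimes>\<^bsub>A\<^esub> v j"
            if "j \<in> {..<n}" for j
            using that *[OF that] by (simp add: A.r_distr)
          show "(\<lambda>j. \<Phi> $$ (i, j) \<otimes>\<^bsub>A\<^esub> u j \<oplus>\<^bsub>A\<^esub> \<Phi> $$ (i, j) \<otimes>\<^bsub>A\<^esub> v j) \<in> {..<n} \<rightarrow> carrier A"
            using * by auto
        qed simp
        also have "\<dots> = (\<Oplus>\<^bsub>A\<^esub>j\<in>{..<n}. \<Phi> $$ (i, j) \<otimes>\<^bsub>A\<^esub> u j) \<oplus>\<^bsub>A\<^esub> (\<Oplus>\<^bsub>A\<^esub>j\<in>{..<n}. \<Phi> $$ (i, j) \<otimes>\<^bsub>A\<^esub> v j)"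
          using 3 assms(3) True by (intro A.finsum_addf) auto
        finally show ?thesis using True by simp
      qed simp
    qed
  next
    case (4 c v)
    show ?case
    proof
      fix i
      show "(\<lambda>i\<in>{..<m}. \<Oplus>\<^bsub>A\<^esub>j\<in>{..<n}. \<Phi> $$ (i, j) \<otimes>\<^bsub>A\<^esub> (\<lambda>i\<in>{..<n}. c \<otimes>\<^bsub>A\<^esub> v i) j) i =
        (\<lambda>i\<in>{..<m}. c \<otimes>\<^bsub>A\<^esub> (\<lambda>i\<in>{..<m}. \<Oplus>\<^bsub>A\<^esub>j\<in>{..<n}. \<Phi> $$ (i, j) \<otimes>\<^bsub>A\<^esub> v j) i) i"
      proof (cases "i < m")
        case True
        have "(\<Oplus>\<^bsub>A\<^esub>j\<in>{..<n}. \<Phi> $$ (i, j) \<otimes>\<^bsub>A\<^esub> (\<lambda>i\<in>{..<n}. c \<otimes>\<^bsub>A\<^esub> v i) j) =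
          (\<Oplus>\<^bsub>A\<^esub>j\<in>{..<n}. c \<otimes>\<^bsub>A\<^esub> (\<Phi> $$ (i, j) \<otimes>\<^bsub>A\<^esub> v j))"
        proof (rule A.finsum_cong')
          fix j assume j: "j \<in> {..<n}"
          then have "v j \<in> carrier A" "\<Phi> $$ (i, j) \<in> carrier A" using 4 assms(3) True by auto
          then show "\<Phi> $$ (i, j) \<otimes>\<^bsub>A\<^esub> (\<lambda>i\<in>{..<n}. c \<otimes>\<^bsub>A\<^esub> v i) j = c \<otimes>\<^bsub>A\<^esub> (\<Phi> $$ (i, j) \<otimes>\<^bsub>A\<^esub> v j)"
            using j 4(1) by (simp add: A.m_lcomm)
        next
          show "(\<lambda>j. c \<otimes>\<^bsub>A\<^esub> (\<Phi> $$ (i, j) \<otimes>\<^bsub>A\<^esub> v j)) \<in> {..<n} \<rightarrow> carrier A"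
          proof
            fix j assume "j \<in> {..<n}"
            then have "v j \<in> carrier A" "\<Phi> $$ (i, j) \<in> carrier A" using 4 assms(3) True by auto
            then show "c \<otimes>\<^bsub>A\<^esub> (\<Phi> $$ (i, j) \<otimes>\<^bsub>A\<^esub> v j) \<in> carrier A" using 4(1) by simp
          qed
        qed simp
        also have "\<dots> = c \<otimes>\<^bsub>A\<^esub> (\<Oplus>\<^bsub>A\<^esub>j\<in>{..<n}. \<Phi> $$ (i, j) \<otimes>\<^bsub>A\<^esub> v j)"
          using 4 assms(3) True by (intro A.finsum_rdistr[symmetric]) auto
        finally show ?thesis using True by simp
      qed simp
    qed
  qed
qed

lemma matrix_map_eq_mult_mat_vec:
  fixes \<Phi> :: "'a::comm_ring_1 mat"
  assumes "\<Phi> \<in> carrier_mat m n" "i < m"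
  shows "matrix_map class_ring \<Phi> v i = (\<Phi> *\<^sub>v vec n v) $ i"
  using assms by (auto simp: matrix_map_def class_ring_simps scalar_prod_def lessThan_atLeast0 intro!: sum.cong)

lemma mat_mult_unit_vec_index:
  fixes C :: "'a::comm_ring_1 mat"
  shows "C \<in> carrier_mat n n \<Longrightarrow> i < n \<Longrightarrow> j < n \<Longrightarrow> (C *\<^sub>v unit_vec n j) $ i = C $$ (i, j)"
  by simp

lemma matrix_factorization_iff_mat:
  fixes \<alpha> \<beta> :: "'a::comm_ring_1 mat"
  assumes "\<alpha> \<in> carrier_mat n n" "\<beta> \<in> carrier_mat n n"
  shows "matrix_factorization class_ring x (free_space class_ring n) (free_space class_ring n)
           (matrix_map class_ring \<alpha>) (matrix_map class_ring \<beta>) \<longleftrightarrow>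
         \<alpha> * \<beta> = x \<cdot>\<^sub>m 1\<^sub>m n \<and> \<beta> * \<alpha> = x \<cdot>\<^sub>m 1\<^sub>m n"
proof -
  let ?A = "class_ring :: 'a ring"
  have cr: "cring ?A" by (rule class_cring.cring_axioms)
  then have r: "ring ?A" by (rule cring.axioms)
  have comp: "(\<forall>v\<in>carrier (free_space ?A n).
       matrix_map ?A \<Phi> (matrix_map ?A \<Psi> v) = x \<odot>\<^bsub>free_space ?A n\<^esub> v) \<longleftrightarrow> \<Phi> * \<Psi> = x \<cdot>\<^sub>m 1\<^sub>m n" (is "?L = ?R")
    if P: "\<Phi> \<in> carrier_mat n n" and Q: "\<Psi> \<in> carrier_mat n n" for \<Phi> \<Psi> :: "'a mat"
  proof -
    have vm: "vec n (matrix_map ?A \<Psi> v) = \<Psi> *\<^sub>v vec n v" for v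
      using Q by (intro eq_vecI) (auto simp: matrix_map_eq_mult_mat_vec[OF Q] simp del: index_mult_mat_vec)
    have ev: "matrix_map ?A \<Phi> (matrix_map ?A \<Psi> v) i = ((\<Phi> * \<Psi>) *\<^sub>v vec n v) $ i" if "i < n" for v i
      unfolding matrix_map_eq_mult_mat_vec[OF P that] vm using P Q by (subst assoc_mult_mat_vec) auto
    have L: "?L \<longleftrightarrow> (\<forall>v\<in>carrier (free_space ?A n). \<forall>i<n. ((\<Phi> * \<Psi>) *\<^sub>v vec n v) $ i = x * v i)"
    proof (intro ball_cong refl iffI allI impI)
      fix v i assume "matrix_map ?A \<Phi> (matrix_map ?A \<Psi> v) = x \<odot>\<^bsub>free_space ?A n\<^esub> v" "i < n"
      then show "((\<Phi> * \<Psi>) *\<^sub>v vec n v) $ i = x * v i" using ev[of i v] by (simp add: free_space_smult[OF r])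
    next
      fix v assume a: "\<forall>i<n. ((\<Phi> * \<Psi>) *\<^sub>v vec n v) $ i = x * v i"
      show "matrix_map ?A \<Phi> (matrix_map ?A \<Psi> v) = x \<odot>\<^bsub>free_space ?A n\<^esub> v"
      proof
        fix i show "matrix_map ?A \<Phi> (matrix_map ?A \<Psi> v) i = (x \<odot>\<^bsub>free_space ?A n\<^esub> v) i"
        proof (cases "i < n")
          case True then show ?thesis using ev[OF True, of v] a by (simp add: free_space_smult[OF r])
        next
          case False then show ?thesis using P by (simp add: free_space_smult[OF r] matrix_map_def)
        qed
      qed
    qed
    show ?thesis unfolding L
    proof
      assume a: "\<forall>v\<in>carrier (free_space ?A n). \<forall>i<n. ((\<Phi> * \<Psi>) *\<^sub>v vec n v) $ i = x * v i"
      show ?R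
      proof (rule eq_matI)
        fix i j assume ij: "i < dim_row (x \<cdot>\<^sub>m 1\<^sub>m n)" "j < dim_col (x \<cdot>\<^sub>m 1\<^sub>m n)"
        define v where "v = (\<lambda>k\<in>{..<n}. if k = j then 1 else 0 :: 'a)"
        have "v \<in> carrier (free_space ?A n)" by (auto simp: free_space_carrier[OF r] v_def)
        moreover have "vec n v = unit_vec n j" by (auto simp: v_def unit_vec_def)
        ultimately have "((\<Phi> * \<Psi>) *\<^sub>v unit_vec n j) $ i = x * v i" using a ij by auto
        moreover have "((\<Phi> * \<Psi>) *\<^sub>v unit_vec n j) $ i = (\<Phi> * \<Psi>) $$ (i, j)"
          using mat_mult_unit_vec_index[OF mult_carrier_mat[OF P Q]] ij by simp
        ultimately show "(\<Phi> * \<Psi>) $$ (i, j) = (x \<cdot>\<^sub>m 1\<^sub>m n) $$ (i, j)" using ij by (auto simp: v_def)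
      qed (use P Q in auto)
    next
      assume R: ?R
      show "\<forall>v\<in>carrier (free_space ?A n). \<forall>i<n. ((\<Phi> * \<Psi>) *\<^sub>v vec n v) $ i = x * v i"
        unfolding R by (auto simp: smult_scalar_prod_distrib)
    qed
  qed
  show ?thesis unfolding matrix_factorization_def
    using comp[OF assms] comp[OF assms(2,1)] free_module_free_space[OF cr]
      matrix_map_module_hom[OF cr assms(1)] matrix_map_module_hom[OF cr assms(2)] by simp
qed

lemma quotient_module_module:
  assumes "LinearCombinations.submodule A N M"
  shows "Module.module A (quotient_module M N)"
    and "\<And>a x. a \<in> carrier A \<Longrightarrow> x \<in> carrier M \<Longrightarrow>
           a \<odot>\<^bsub>quotient_module M N\<^esub> (N +>\<^bsub>M\<^esub> x) = N +>\<^bsub>M\<^esub> (a \<odot>\<^bsub>M\<^esub> x)"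
proof -
  interpret N: LinearCombinations.submodule A N M by fact
  interpret M: Module.module A M by (rule N.module)
  have "subgroup N (add_monoid M)"
  proof (rule M.M.add.subgroupI)
    fix x assume x: "x \<in> N"
    then have xM: "x \<in> carrier M" using N.subset by auto
    have "(\<ominus>\<^bsub>A\<^esub> \<one>\<^bsub>A\<^esub>) \<odot>\<^bsub>M\<^esub> x \<in> N" by (rule N.smult_closed) (use x in auto)
    moreover have "(\<ominus>\<^bsub>A\<^esub> \<one>\<^bsub>A\<^esub>) \<odot>\<^bsub>M\<^esub> x = \<ominus>\<^bsub>M\<^esub> x" using M.smult_l_minus[of "\<one>\<^bsub>A\<^esub>" x] xM by simp
    ultimately show "\<ominus>\<^bsub>M\<^esub> x \<in> N" by simp
  next
    show "N \<noteq> {}" using N.zero_closed by blast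
  qed (use N.subset in auto)
  then interpret N': abelian_subgroup N M
    by (intro abelian_subgroupI3 additive_subgroup.intro M.abelian_group_axioms)
  have smult: "a \<odot>\<^bsub>quotient_module M N\<^esub> (N +>\<^bsub>M\<^esub> x) = N +>\<^bsub>M\<^esub> (a \<odot>\<^bsub>M\<^esub> x)"
    if a: "a \<in> carrier A" and x: "x \<in> carrier M" for a x
  proof -
    have "N +>\<^bsub>M\<^esub> (a \<odot>\<^bsub>M\<^esub> y) = N +>\<^bsub>M\<^esub> (a \<odot>\<^bsub>M\<^esub> x)" if "y \<in> N +>\<^bsub>M\<^esub> x" for y
    proof -
      from that obtain h where h: "h \<in> N" "y = h \<oplus>\<^bsub>M\<^esub> x" by (auto simp: a_r_coset_def')
      have hM: "h \<in> carrier M" using h N.subset by auto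
      have "a \<odot>\<^bsub>M\<^esub> y = a \<odot>\<^bsub>M\<^esub> h \<oplus>\<^bsub>M\<^esub> a \<odot>\<^bsub>M\<^esub> x" using h hM a x by (simp add: M.smult_r_distr)
      moreover have "a \<odot>\<^bsub>M\<^esub> h \<in> N" using h a by simp
      ultimately have "a \<odot>\<^bsub>M\<^esub> y \<in> N +>\<^bsub>M\<^esub> (a \<odot>\<^bsub>M\<^esub> x)" by (auto simp: a_r_coset_def')
      from N'.a_repr_independence'[OF this] show ?thesis using a x M.smult_closed by simp
    qed
    moreover have "x \<in> N +>\<^bsub>M\<^esub> x" using N'.a_rcos_self x by blast
    ultimately have "(\<Union>y\<in>N +>\<^bsub>M\<^esub> x. N +>\<^bsub>M\<^esub> (a \<odot>\<^bsub>M\<^esub> y)) = N +>\<^bsub>M\<^esub> (a \<odot>\<^bsub>M\<^esub> x)"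
      by blast
    then show ?thesis by (simp add: quotient_module_def)
  qed
  show "\<And>a x. a \<in> carrier A \<Longrightarrow> x \<in> carrier M \<Longrightarrow>
           a \<odot>\<^bsub>quotient_module M N\<^esub> (N +>\<^bsub>M\<^esub> x) = N +>\<^bsub>M\<^esub> (a \<odot>\<^bsub>M\<^esub> x)" by (rule smult)
  have car: "X \<in> carrier (quotient_module M N) \<longleftrightarrow> (\<exists>x\<in>carrier M. X = N +>\<^bsub>M\<^esub> x)" for X
    by (auto simp: quotient_module_def A_RCOSETS_def')
  have add: "(N +>\<^bsub>M\<^esub> x) \<oplus>\<^bsub>quotient_module M N\<^esub> (N +>\<^bsub>M\<^esub> y) = N +>\<^bsub>M\<^esub> (x \<oplus>\<^bsub>M\<^esub> y)"
    if "x \<in> carrier M" "y \<in> carrier M" for x y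
    using that N'.a_rcos_sum by (simp add: quotient_module_def)
  have zero: "\<zero>\<^bsub>quotient_module M N\<^esub> = N +>\<^bsub>M\<^esub> \<zero>\<^bsub>M\<^esub>"
    using M.M.a_coset_add_zero[OF N.subset] by (simp add: quotient_module_def)
  note rw = add smult zero
  show "Module.module A (quotient_module M N)"
  proof (rule moduleI[OF M.R.cring_axioms abelian_groupI])
    fix X assume "X \<in> carrier (quotient_module M N)"
    then obtain x where x: "x \<in> carrier M" "X = N +>\<^bsub>M\<^esub> x" by (auto simp: car)
    show "\<exists>Y\<in>carrier (quotient_module M N). Y \<oplus>\<^bsub>quotient_module M N\<^esub> X = \<zero>\<^bsub>quotient_module M N\<^esub>"
      by (rule bexI[of _ "N +>\<^bsub>M\<^esub> (\<ominus>\<^bsub>M\<^esub> x)"]) (use x in \<open>auto simp: car rw M.M.l_neg\<close>)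
  next
    fix X Y assume "X \<in> carrier (quotient_module M N)" "Y \<in> carrier (quotient_module M N)"
    then obtain x y where x: "x \<in> carrier M" "X = N +>\<^bsub>M\<^esub> x" and y: "y \<in> carrier M" "Y = N +>\<^bsub>M\<^esub> y"
      by (auto simp: car)
    show "X \<oplus>\<^bsub>quotient_module M N\<^esub> Y = Y \<oplus>\<^bsub>quotient_module M N\<^esub> X"
      using x y by (simp add: rw M.M.a_comm)
    show "X \<oplus>\<^bsub>quotient_module M N\<^esub> Y \<in> carrier (quotient_module M N)"
      unfolding car x(2) y(2) add[OF x(1) y(1)] using x(1) y(1) by blast
  next
    fix a X assume "a \<in> carrier A" "X \<in> carrier (quotient_module M N)"
    then obtain x where x: "a \<in> carrier A" "x \<in> carrier M" "X = N +>\<^bsub>M\<^esub> x" by (auto simp: car)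
    show "a \<odot>\<^bsub>quotient_module M N\<^esub> X \<in> carrier (quotient_module M N)"
      unfolding car x(3) smult[OF x(1,2)] using x(1,2) by blast
  next
    show "\<zero>\<^bsub>quotient_module M N\<^esub> \<in> carrier (quotient_module M N)"
      unfolding car zero by blast
  qed (auto simp: car rw M.M.a_assoc M.smult_l_distr M.smult_r_distr M.smult_assoc1)
qed

lemma trace_ideal_eq_genideal:
  assumes "Module.module A M"
  shows "trace_ideal A M = Idl\<^bsub>A\<^esub> (\<Union>f\<in>module_hom A M (regular_module A). f ` carrier M)" (is "_ = Idl\<^bsub>A\<^esub> ?U")
proof -
  interpret M: Module.module A M by fact
  have U: "?U \<subseteq> carrier A" by (auto simp: module_hom_def regular_module_def)
  have fin: "f i (m i) \<in> carrier A" if "\<forall>i<k. f i \<in> module_hom A M (regular_module A) \<and> m i \<in> carrier M" "i < k"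
    for f m and i k :: nat using that U by auto
  have id: "ideal (trace_ideal A M) A"
  proof (rule idealI)
    show "ring A" by (rule M.R.ring_axioms)
    have smul: "r \<otimes>\<^bsub>A\<^esub> x \<in> trace_ideal A M" if x: "x \<in> trace_ideal A M" and r: "r \<in> carrier A" for r x
    proof -
      from x obtain k :: nat and f m where
        1: "x = (\<Oplus>\<^bsub>A\<^esub> i\<in>{..<k}. f i (m i))" "\<forall>i<k. f i \<in> module_hom A M (regular_module A) \<and> m i \<in> carrier M"
        by (auto simp: trace_ideal_def)
      have "r \<otimes>\<^bsub>A\<^esub> x = (\<Oplus>\<^bsub>A\<^esub> i\<in>{..<k}. r \<otimes>\<^bsub>A\<^esub> f i (m i))"
        unfolding 1(1) using r fin[OF 1(2)] by (intro M.R.finsum_rdistr) auto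
      also have "\<dots> = (\<Oplus>\<^bsub>A\<^esub> i\<in>{..<k}. f i (r \<odot>\<^bsub>M\<^esub> m i))"
        using r fin[OF 1(2)] 1(2) by (intro M.R.finsum_cong') (auto simp: module_hom_def regular_module_def)
      finally show ?thesis unfolding trace_ideal_def using 1(2) r
        by (intro CollectI exI[of _ k] exI[of _ f] exI[of _ "\<lambda>i. r \<odot>\<^bsub>M\<^esub> m i"]) auto
    qed
    show "r \<otimes>\<^bsub>A\<^esub> x \<in> trace_ideal A M" if "x \<in> trace_ideal A M" "r \<in> carrier A" for r x
      using smul[OF that] .
    have sub: "trace_ideal A M \<subseteq> carrier A" using fin by (auto simp: trace_ideal_def intro!: M.R.finsum_closed)
    show "x \<otimes>\<^bsub>A\<^esub> r \<in> trace_ideal A M" if "x \<in> trace_ideal A M" "r \<in> carrier A" for r x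
      using smul[OF that] sub that M.R.m_comm[of x r] by auto
    show "subgroup (trace_ideal A M) (add_monoid A)"
    proof (rule M.R.add.subgroupI)
      show "trace_ideal A M \<subseteq> carrier A" by (rule sub)
      show "trace_ideal A M \<noteq> {}" by (auto simp: trace_ideal_def intro!: exI[of _ "0::nat"])
      fix x assume x: "x \<in> trace_ideal A M"
      have "\<ominus>\<^bsub>A\<^esub> \<one>\<^bsub>A\<^esub> \<otimes>\<^bsub>A\<^esub> x = \<ominus>\<^bsub>A\<^esub> x" using x sub by (auto simp: M.R.l_minus)
      then show "\<ominus>\<^bsub>A\<^esub> x \<in> trace_ideal A M" using smul[OF x, of "\<ominus>\<^bsub>A\<^esub> \<one>\<^bsub>A\<^esub>"] by simp
      fix y assume y: "y \<in> trace_ideal A M"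
      from x obtain k :: nat and f m where
        1: "x = (\<Oplus>\<^bsub>A\<^esub> i\<in>{..<k}. f i (m i))" "\<forall>i<k. f i \<in> module_hom A M (regular_module A) \<and> m i \<in> carrier M"
        by (auto simp: trace_ideal_def)
      from y obtain l :: nat and f' m' where
        2: "y = (\<Oplus>\<^bsub>A\<^esub> i\<in>{..<l}. f' i (m' i))" "\<forall>i<l. f' i \<in> module_hom A M (regular_module A) \<and> m' i \<in> carrier M"
        by (auto simp: trace_ideal_def)
      define F where "F i = (if i < k then f i else f' (i - k))" for i
      define m2 where "m2 i = (if i < k then m i else m' (i - k))" for i
      have F: "\<forall>i<k+l. F i \<in> module_hom A M (regular_module A) \<and> m2 i \<in> carrier M"
        using 1(2) 2(2) by (auto simp: F_def m2_def)
      have un: "{..<k+l} = {..<k} \<union> (\<lambda>i. i + k) ` {..<l}"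
      proof (intro equalityI subsetI)
        fix i assume "i \<in> {..<k+l}"
        then show "i \<in> {..<k} \<union> (\<lambda>i. i + k) ` {..<l}"
          by (cases "i < k") (auto intro!: image_eqI[of _ _ "i - k"])
      qed auto
      have "(\<Oplus>\<^bsub>A\<^esub> i\<in>{..<k+l}. F i (m2 i)) = (\<Oplus>\<^bsub>A\<^esub> i\<in>{..<k}. F i (m2 i)) \<oplus>\<^bsub>A\<^esub> (\<Oplus>\<^bsub>A\<^esub> i\<in>(\<lambda>i. i + k) ` {..<l}. F i (m2 i))"
        unfolding un using fin[OF F] by (intro M.R.finsum_Un_disjoint) auto
      also have "(\<Oplus>\<^bsub>A\<^esub> i\<in>(\<lambda>i. i + k) ` {..<l}. F i (m2 i)) = (\<Oplus>\<^bsub>A\<^esub> i\<in>{..<l}. F (i + k) (m2 (i + k)))"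
        using fin[OF F] by (intro M.R.finsum_reindex) (auto simp: inj_on_def)
      also have "\<dots> = y" unfolding 2(1) using fin[OF 2(2)]
        by (intro M.R.finsum_cong') (auto simp: F_def m2_def)
      also have "(\<Oplus>\<^bsub>A\<^esub> i\<in>{..<k}. F i (m2 i)) = x" unfolding 1(1) using fin[OF 1(2)]
        by (intro M.R.finsum_cong') (auto simp: F_def m2_def)
      finally have "x \<oplus>\<^bsub>A\<^esub> y = (\<Oplus>\<^bsub>A\<^esub> i\<in>{..<k+l}. F i (m2 i))" by simp
      then show "x \<oplus>\<^bsub>A\<^esub> y \<in> trace_ideal A M" unfolding trace_ideal_def using F by blast
    qed
  qed
  show ?thesis
  proof
    have "?U \<subseteq> trace_ideal A M"
    proof
      fix x assume "x \<in> ?U"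
      then obtain f m where f: "f \<in> module_hom A M (regular_module A)" "m \<in> carrier M" "x = f m" by auto
      then have "x \<in> carrier A" using \<open>x \<in> ?U\<close> U by blast
      then have "x = (\<Oplus>\<^bsub>A\<^esub> i\<in>{..<1::nat}. f m)" using f by (simp add: lessThan_Suc)
      then show "x \<in> trace_ideal A M" unfolding trace_ideal_def using f(1,2)
        by (intro CollectI exI[of _ "1::nat"] exI[of _ "\<lambda>_. f"] exI[of _ "\<lambda>_. m"]) simp
    qed
    then show "Idl\<^bsub>A\<^esub> ?U \<subseteq> trace_ideal A M" by (rule M.R.genideal_minimal[OF id])
    interpret J: ideal "Idl\<^bsub>A\<^esub> ?U" A by (rule M.R.genideal_ideal[OF U])
    have clos: "(\<Oplus>\<^bsub>A\<^esub> i\<in>{..<k}. h i) \<in> Idl\<^bsub>A\<^esub> ?U" if "\<And>i. i < k \<Longrightarrow> h i \<in> Idl\<^bsub>A\<^esub> ?U" for h and k :: nat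
      using that
    proof (induction k)
      case (Suc k)
      have "(\<Oplus>\<^bsub>A\<^esub> i\<in>{..<Suc k}. h i) = h k \<oplus>\<^bsub>A\<^esub> (\<Oplus>\<^bsub>A\<^esub> i\<in>{..<k}. h i)"
        unfolding lessThan_Suc using Suc.prems J.a_subset by (intro M.R.finsum_insert) auto
      then show ?case using Suc by (auto intro!: J.a_closed)
    qed auto
    show "trace_ideal A M \<subseteq> Idl\<^bsub>A\<^esub> ?U"
      using M.R.genideal_self[OF U] by (auto simp: trace_ideal_def intro!: clos)
  qed
qed

end

theory Submission
  imports Defs
begin

text \<open>
  Write \<open>C = z Id - \<phi>\<close>, \<open>B = z Id + \<phi>\<close> and \<open>x = z\<^sup>2 + g\<close>. A homomorphism from \<open>M\<close> to \<open>R\<close> is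
  a linear form on \<open>R\<^sup>n\<close> that kills the columns of \<open>C\<close> modulo \<open>x\<close>, that is, a row vector \<open>v\<close> over \<open>R\<close>
  with \<open>v C = 0\<close>. Its image is generated by the entries of \<open>v\<close>, so the trace ideal is generated by
  the entries of all such rows (\<open>trace_ideal_cokernel\<close>). The theorem follows once these rows are known
  to be the combinations of the rows of \<open>B\<close> modulo \<open>x\<close>. The rows of \<open>B\<close> qualify because \<open>B C = x Id\<close>
  vanishes modulo \<open>x\<close>. Conversely, lift \<open>v\<close> to a row \<open>a\<close> of power series; then \<open>a C = x u\<close> for some
  row \<open>u\<close>, and multiplying by \<open>B\<close> on the right gives \<open>x a = a C B = x (u B)\<close>. If \<open>x\<close> is a
  nonzerodivisor this says \<open>a = u B\<close> (\<open>trace_ideal_cokernel_matrix_factorization\<close>).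

  That \<open>z\<^sup>2 + g\<close> is a nonzerodivisor of \<open>S[[z]]\<close> rests on the ascending chain condition in \<open>S\<close>
  (\<open>X2_plus_const_nonzerodivisor\<close>). If it kills \<open>f\<close>, then each coefficient of \<open>f\<close> is \<open>-g\<close> times the
  coefficient two places further on, so the coefficients of even index generate an ascending chain of
  ideals, and so do those of odd index.
\<close>

section \<open>Homomorphisms out of a quotient module\<close>

lemma module_homI:
  assumes "\<And>x. x \<in> carrier M \<Longrightarrow> f x \<in> carrier P"
    and "\<And>x y. x \<in> carrier M \<Longrightarrow> y \<in> carrier M \<Longrightarrow> f (x \<oplus>\<^bsub>M\<^esub> y) = f x \<oplus>\<^bsub>P\<^esub> f y"
    and "\<And>a x. a \<in> carrier A \<Longrightarrow> x \<in> carrier M \<Longrightarrow> f (a \<odot>\<^bsub>M\<^esub> x) = a \<odot>\<^bsub>P\<^esub> f x"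
  shows "f \<in> module_hom A M P"
  using assms by (auto simp: module_hom_def)

lemma quotient_module_carrier:
  "carrier (quotient_module M N) = (\<lambda>x. N +>\<^bsub>M\<^esub> x) ` carrier M"
  by (auto simp: quotient_module_def A_RCOSETS_def')

lemma submodule_abelian_subgroup:
  assumes "LinearCombinations.submodule A N M"
  shows "abelian_subgroup N M"
proof -
  interpret N: LinearCombinations.submodule A N M by fact
  interpret M: Module.module A M by (rule N.module)
  have "subgroup N (add_monoid M)"
  proof (rule M.M.add.subgroupI)
    fix x assume "x \<in> N"
    then have "(\<ominus>\<^bsub>A\<^esub> \<one>\<^bsub>A\<^esub>) \<odot>\<^bsub>M\<^esub> x \<in> N" "x \<in> carrier M" using N.subset by auto
    then show "\<ominus>\<^bsub>M\<^esub> x \<in> N" using M.smult_l_minus[of "\<one>\<^bsub>A\<^esub>" x] by simp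
  next
    show "N \<noteq> {}" using N.zero_closed by blast
  qed (use N.subset in auto)
  then show ?thesis
    by (intro abelian_subgroupI3 additive_subgroup.intro M.abelian_group_axioms)
qed

lemma quotient_module_proj_hom:
  assumes "LinearCombinations.submodule A N M"
  shows "(\<lambda>x. N +>\<^bsub>M\<^esub> x) \<in> module_hom A M (quotient_module M N)"
proof -
  interpret N: abelian_subgroup N M by (rule submodule_abelian_subgroup[OF assms])
  have "(N +>\<^bsub>M\<^esub> x) \<oplus>\<^bsub>quotient_module M N\<^esub> (N +>\<^bsub>M\<^esub> y) = N +>\<^bsub>M\<^esub> (x \<oplus>\<^bsub>M\<^esub> y)"
    if "x \<in> carrier M" "y \<in> carrier M" for x y
    using N.a_rcos_sum[OF that] by (simp add: quotient_module_def)
  then show ?thesis unfolding module_hom_def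
    using quotient_module_module(2)[OF assms] by (auto simp: quotient_module_carrier)
qed

text \<open>The universal property of the quotient. Since \<open>h\<close> is constant on cosets, the induced map may
  evaluate \<open>h\<close> at any chosen representative.\<close>

lemma quotient_module_hom_lift:
  assumes N: "LinearCombinations.submodule A N M" and P: "Module.module A P"
    and h: "h \<in> module_hom A M P" and van: "\<And>x. x \<in> N \<Longrightarrow> h x = \<zero>\<^bsub>P\<^esub>"
  obtains f where "f \<in> module_hom A (quotient_module M N) P"
    and "\<And>x. x \<in> carrier M \<Longrightarrow> f (N +>\<^bsub>M\<^esub> x) = h x"
proof
  interpret N: LinearCombinations.submodule A N M by fact
  interpret M: Module.module A M by (rule N.module)
  interpret P: Module.module A P by fact
  interpret N': abelian_subgroup N M by (rule submodule_abelian_subgroup[OF N])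
  define f where "f X = h (SOME x. x \<in> X)" for X
  show f: "f (N +>\<^bsub>M\<^esub> x) = h x" if x: "x \<in> carrier M" for x
  proof -
    have "(SOME y. y \<in> N +>\<^bsub>M\<^esub> x) \<in> N +>\<^bsub>M\<^esub> x"
      by (rule someI) (rule N'.a_rcos_self[OF x])
    then obtain y where y: "y \<in> N" "(SOME y. y \<in> N +>\<^bsub>M\<^esub> x) = y \<oplus>\<^bsub>M\<^esub> x"
      by (auto simp: a_r_coset_def')
    then have "f (N +>\<^bsub>M\<^esub> x) = h y \<oplus>\<^bsub>P\<^esub> h x"
      using h x N.subset by (auto simp: f_def module_hom_add)
    moreover have "h x \<in> carrier P" using module_hom_closed[OF h] x by auto
    ultimately show ?thesis using van[OF y(1)] P.M.l_zero by simp
  qed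
  show "f \<in> module_hom A (quotient_module M N) P"
  proof (rule module_homI)
    fix X Y assume "X \<in> carrier (quotient_module M N)" "Y \<in> carrier (quotient_module M N)"
    then obtain x y where x: "x \<in> carrier M" "X = N +>\<^bsub>M\<^esub> x" and y: "y \<in> carrier M" "Y = N +>\<^bsub>M\<^esub> y"
      by (auto simp: quotient_module_carrier)
    have "X \<oplus>\<^bsub>quotient_module M N\<^esub> Y = N +>\<^bsub>M\<^esub> (x \<oplus>\<^bsub>M\<^esub> y)"
      using module_hom_add[OF quotient_module_proj_hom[OF N] x(1) y(1)] x y by simp
    then show "f (X \<oplus>\<^bsub>quotient_module M N\<^esub> Y) = f X \<oplus>\<^bsub>P\<^esub> f Y"
      using x y h by (simp add: f module_hom_add)
  next
    fix a X assume a: "a \<in> carrier A" and "X \<in> carrier (quotient_module M N)"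
    then obtain x where x: "x \<in> carrier M" "X = N +>\<^bsub>M\<^esub> x" by (auto simp: quotient_module_carrier)
    show "f (a \<odot>\<^bsub>quotient_module M N\<^esub> X) = a \<odot>\<^bsub>P\<^esub> f X"
      using a x h quotient_module_module(2)[OF N a x(1)] by (simp add: f module_hom_smult)
  qed (use module_hom_closed[OF h] f in \<open>auto simp: quotient_module_carrier\<close>)
qed

lemma module_hom_comp:
  assumes "f \<in> module_hom A L M" "h \<in> module_hom A M P"
  shows "(\<lambda>x. h (f x)) \<in> module_hom A L P"
  using assms by (auto simp: module_hom_def Pi_iff)

lemma module_hom_image_submodule:
  assumes "Module.module A M" "Module.module A P" "f \<in> module_hom A M P"
  shows "LinearCombinations.submodule A (f ` carrier M) P"
proof -
  have "mod_hom A M P f"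
    using assms by (simp add: mod_hom_def mod_hom_axioms_def)
  from mod_hom.im_is_submodule[OF this] show ?thesis by (simp add: mod_hom.im_def[OF \<open>mod_hom A M P f\<close>])
qed

section \<open>Linear forms on a free module\<close>

lemma regular_module_simps:
  "carrier (regular_module A) = carrier A" "\<zero>\<^bsub>regular_module A\<^esub> = \<zero>\<^bsub>A\<^esub>"
  "add (regular_module A) = add A" "smult (regular_module A) = mult A"
  by (simp_all add: regular_module_def)

lemma regular_module_module:
  assumes "cring A"
  shows "Module.module A (regular_module A)"
proof -
  interpret A: cring A by fact
  show ?thesis
    by (intro moduleI abelian_groupI)
      (auto simp: regular_module_simps A.l_distr A.r_distr A.m_assoc A.a_ac
        intro: A.cring_axioms A.l_neg)
qed

lemma finsum_regular_module: "finsum (regular_module A) = finsum A"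
  by (simp add: fun_eq_iff finsum_def finprod_def regular_module_def)

lemma module_hom_finsum:
  assumes "Module.module A M" "Module.module A P" "f \<in> module_hom A M P"
    and "finite I" "\<And>i. i \<in> I \<Longrightarrow> h i \<in> carrier M"
  shows "f (finsum M h I) = finsum P (\<lambda>i. f (h i)) I"
proof -
  interpret f: mod_hom A M P f
    using assms by (simp add: mod_hom_def mod_hom_axioms_def)
  show ?thesis using assms(4,5)
  proof (induction I rule: finite_induct)
    case (insert i I)
    then have "finsum M h (insert i I) = h i \<oplus>\<^bsub>M\<^esub> finsum M h I"
      and "finsum P (\<lambda>i. f (h i)) (insert i I) = f (h i) \<oplus>\<^bsub>P\<^esub> finsum P (\<lambda>i. f (h i)) I"
      and "finsum M h I \<in> carrier M"
      by (auto intro!: f.M.M.finsum_insert f.N.M.finsum_insert f.M.M.finsum_closed f.f_im)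
    then show ?case using insert by simp
  qed simp
qed

definition unit_fun :: "('a, 'b) ring_scheme \<Rightarrow> nat \<Rightarrow> nat \<Rightarrow> nat \<Rightarrow> 'a" where
  "unit_fun A n j = (\<lambda>i\<in>{..<n}. if i = j then \<one>\<^bsub>A\<^esub> else \<zero>\<^bsub>A\<^esub>)"

lemma unit_fun_carrier:
  assumes "cring A"
  shows "unit_fun A n j \<in> carrier (free_space A n)"
proof -
  interpret A: cring A by fact
  show ?thesis by (auto simp: free_space_carrier[OF A.ring_axioms] unit_fun_def)
qed

text \<open>A linear form is determined by its values on the standard basis, because every vector is the
  combination of basis vectors with its own components as coefficients.\<close>

lemma free_space_form_eq:
  assumes "cring A" "f \<in> module_hom A (free_space A n) (regular_module A)" "w \<in> carrier (free_space A n)"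
  shows "f w = (\<Oplus>\<^bsub>A\<^esub> i\<in>{..<n}. w i \<otimes>\<^bsub>A\<^esub> f (unit_fun A n i))"
proof -
  interpret A: cring A by fact
  interpret F: Module.module A "free_space A n" by (rule A.func_space_is_module)
  have w: "w \<in> {..<n} \<rightarrow>\<^sub>E carrier A" using assms(3) by (simp add: free_space_carrier[OF A.ring_axioms])
  have wi: "w i \<in> carrier A" if "i < n" for i using w that by auto
  have e: "w i \<odot>\<^bsub>free_space A n\<^esub> unit_fun A n i \<in> carrier (free_space A n)" if "i < n" for i
    using wi[OF that] unit_fun_carrier[OF assms(1)] by (rule F.smult_closed)
  have "finsum (free_space A n) (\<lambda>i. w i \<odot>\<^bsub>free_space A n\<^esub> unit_fun A n i) {..<n} =
      (\<lambda>k\<in>{..<n}. \<Oplus>\<^bsub>A\<^esub> i\<in>{..<n}. (w i \<odot>\<^bsub>free_space A n\<^esub> unit_fun A n i) k)"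
    using e by (intro free_space_finsum assms(1)) (auto simp: free_space_carrier[OF A.ring_axioms] simp del: PiE_iff)
  also have "\<dots> = (\<lambda>k\<in>{..<n}. w k)"
  proof (rule restrict_ext)
    fix k assume k: "k \<in> {..<n}"
    have "(\<Oplus>\<^bsub>A\<^esub> i\<in>{..<n}. (w i \<odot>\<^bsub>free_space A n\<^esub> unit_fun A n i) k) =
        (\<Oplus>\<^bsub>A\<^esub> i\<in>{..<n}. if k = i then w i else \<zero>\<^bsub>A\<^esub>)"
      using k wi by (intro A.finsum_cong') (auto simp: free_space_smult[OF A.ring_axioms] unit_fun_def)
    also have "\<dots> = w k" using k wi by (intro A.finsum_singleton) auto
    finally show "(\<Oplus>\<^bsub>A\<^esub> i\<in>{..<n}. (w i \<odot>\<^bsub>free_space A n\<^esub> unit_fun A n i) k) = w k" .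
  qed
  also have "\<dots> = w" using w by (auto simp: fun_eq_iff PiE_def extensional_def restrict_def)
  finally have "f w = f (finsum (free_space A n) (\<lambda>i. w i \<odot>\<^bsub>free_space A n\<^esub> unit_fun A n i) {..<n})"
    by simp
  also have "\<dots> = (\<Oplus>\<^bsub>A\<^esub> i\<in>{..<n}. f (w i \<odot>\<^bsub>free_space A n\<^esub> unit_fun A n i))"
    using e module_hom_finsum[OF F.module_axioms regular_module_module[OF assms(1)] assms(2),
        of "{..<n}" "\<lambda>i. w i \<odot>\<^bsub>free_space A n\<^esub> unit_fun A n i"]
    by (simp add: finsum_regular_module)
  also have "\<dots> = (\<Oplus>\<^bsub>A\<^esub> i\<in>{..<n}. w i \<otimes>\<^bsub>A\<^esub> f (unit_fun A n i))"
  proof (rule A.finsum_cong')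
    fix i assume "i \<in> {..<n}"
    then show "f (w i \<odot>\<^bsub>free_space A n\<^esub> unit_fun A n i) = w i \<otimes>\<^bsub>A\<^esub> f (unit_fun A n i)"
      using module_hom_smult[OF assms(2) wi unit_fun_carrier[OF assms(1)]]
      by (simp add: regular_module_simps)
  next
    have "f (unit_fun A n i) \<in> carrier A" for i
      using module_hom_closed[OF assms(2)] unit_fun_carrier[OF assms(1)]
      by (auto simp: regular_module_simps)
    then show "(\<lambda>i. w i \<otimes>\<^bsub>A\<^esub> f (unit_fun A n i)) \<in> {..<n} \<rightarrow> carrier A" using wi by auto
  qed simp
  finally show ?thesis .
qed

lemma row_form_hom:
  assumes "cring A" "v \<in> {..<n} \<rightarrow> carrier A"
  shows "(\<lambda>w. \<Oplus>\<^bsub>A\<^esub> i\<in>{..<n}. v i \<otimes>\<^bsub>A\<^esub> w i) \<in> module_hom A (free_space A n) (regular_module A)"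
proof -
  interpret A: cring A by fact
  note fs = free_space_carrier[OF A.ring_axioms] free_space_add[OF A.ring_axioms]
    free_space_smult[OF A.ring_axioms] regular_module_simps
  have vi: "v i \<in> carrier A" if "i < n" for i using assms(2) that by auto
  show ?thesis
  proof (rule module_homI, unfold fs)
    fix w assume "w \<in> {..<n} \<rightarrow>\<^sub>E carrier A"
    then show "(\<Oplus>\<^bsub>A\<^esub> i\<in>{..<n}. v i \<otimes>\<^bsub>A\<^esub> w i) \<in> carrier A"
      using vi by (auto intro!: A.finsum_closed simp: PiE_iff)
  next
    fix u w assume uw: "u \<in> {..<n} \<rightarrow>\<^sub>E carrier A" "w \<in> {..<n} \<rightarrow>\<^sub>E carrier A"
    have "(\<Oplus>\<^bsub>A\<^esub> i\<in>{..<n}. v i \<otimes>\<^bsub>A\<^esub> (\<lambda>i\<in>{..<n}. u i \<oplus>\<^bsub>A\<^esub> w i) i) =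
        (\<Oplus>\<^bsub>A\<^esub> i\<in>{..<n}. v i \<otimes>\<^bsub>A\<^esub> u i \<oplus>\<^bsub>A\<^esub> v i \<otimes>\<^bsub>A\<^esub> w i)"
      using vi uw by (intro A.finsum_cong') (auto simp: A.r_distr PiE_iff)
    also have "\<dots> = (\<Oplus>\<^bsub>A\<^esub> i\<in>{..<n}. v i \<otimes>\<^bsub>A\<^esub> u i) \<oplus>\<^bsub>A\<^esub> (\<Oplus>\<^bsub>A\<^esub> i\<in>{..<n}. v i \<otimes>\<^bsub>A\<^esub> w i)"
      using vi uw by (intro A.finsum_addf) (auto simp: PiE_iff)
    finally show "(\<Oplus>\<^bsub>A\<^esub> i\<in>{..<n}. v i \<otimes>\<^bsub>A\<^esub> (\<lambda>i\<in>{..<n}. u i \<oplus>\<^bsub>A\<^esub> w i) i) = \<dots>" .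
  next
    fix c w assume cw: "c \<in> carrier A" "w \<in> {..<n} \<rightarrow>\<^sub>E carrier A"
    have "(\<Oplus>\<^bsub>A\<^esub> i\<in>{..<n}. v i \<otimes>\<^bsub>A\<^esub> (\<lambda>i\<in>{..<n}. c \<otimes>\<^bsub>A\<^esub> w i) i) =
        (\<Oplus>\<^bsub>A\<^esub> i\<in>{..<n}. c \<otimes>\<^bsub>A\<^esub> (v i \<otimes>\<^bsub>A\<^esub> w i))"
      using vi cw by (intro A.finsum_cong') (auto simp: A.m_lcomm PiE_iff)
    also have "\<dots> = c \<otimes>\<^bsub>A\<^esub> (\<Oplus>\<^bsub>A\<^esub> i\<in>{..<n}. v i \<otimes>\<^bsub>A\<^esub> w i)"
      using vi cw by (intro A.finsum_rdistr[symmetric]) (auto simp: PiE_iff)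
    finally show "(\<Oplus>\<^bsub>A\<^esub> i\<in>{..<n}. v i \<otimes>\<^bsub>A\<^esub> (\<lambda>i\<in>{..<n}. c \<otimes>\<^bsub>A\<^esub> w i) i) = \<dots>" .
  qed
qed

lemma matrix_map_unit_fun:
  assumes "cring A" "C \<in> carrier_mat n m" "\<And>i j. i < n \<Longrightarrow> j < m \<Longrightarrow> C $$ (i, j) \<in> carrier A" "j < m"
  shows "matrix_map A C (unit_fun A m j) = (\<lambda>i\<in>{..<n}. C $$ (i, j))"
proof -
  interpret A: cring A by fact
  have "(\<Oplus>\<^bsub>A\<^esub> k\<in>{..<m}. C $$ (i, k) \<otimes>\<^bsub>A\<^esub> unit_fun A m j k) = C $$ (i, j)" if i: "i < n" for i
  proof -
    have "(\<Oplus>\<^bsub>A\<^esub> k\<in>{..<m}. C $$ (i, k) \<otimes>\<^bsub>A\<^esub> unit_fun A m j k) =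
        (\<Oplus>\<^bsub>A\<^esub> k\<in>{..<m}. if j = k then C $$ (i, k) else \<zero>\<^bsub>A\<^esub>)"
      using assms(3) i by (intro A.finsum_cong') (auto simp: unit_fun_def)
    also have "\<dots> = C $$ (i, j)"
      using assms(3,4) i by (intro A.finsum_singleton) auto
    finally show ?thesis .
  qed
  then show ?thesis using assms(2) by (auto simp: matrix_map_def)
qed

section \<open>The trace ideal of a cokernel\<close>

lemma ideal_finsum_closed:
  assumes "ideal J A" "finite K" "\<And>i. i \<in> K \<Longrightarrow> h i \<in> J"
  shows "finsum A h K \<in> J"
proof -
  interpret J: ideal J A by fact
  show ?thesis using assms(2,3)
    by (induction K rule: finite_induct) (auto simp: J.finsum_insert Pi_iff J.Icarr)
qed

text \<open>A linear form on the cokernel of \<open>C\<close> is a row vector \<open>v\<close> with \<open>v C = 0\<close>, and its value at the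
  class of a vector is a combination of the entries of \<open>v\<close>, which are themselves the values at the
  classes of the basis vectors.\<close>

lemma trace_ideal_cokernel:
  assumes "cring A" "C \<in> carrier_mat n m" "\<And>i j. i < n \<Longrightarrow> j < m \<Longrightarrow> C $$ (i, j) \<in> carrier A"
  shows "trace_ideal A (cokernel (free_space A m) (free_space A n) (matrix_map A C)) =
    Idl\<^bsub>A\<^esub> {v i | v i. i < n \<and> v \<in> {..<n} \<rightarrow> carrier A \<and>
      (\<forall>j<m. (\<Oplus>\<^bsub>A\<^esub> i\<in>{..<n}. v i \<otimes>\<^bsub>A\<^esub> C $$ (i, j)) = \<zero>\<^bsub>A\<^esub>)}"
proof -
  interpret A: cring A by fact
  let ?F = "free_space A m" and ?G = "free_space A n" and ?P = "regular_module A"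
  let ?c = "matrix_map A C"
  define N where "N = ?c ` carrier ?F"
  have P: "Module.module A ?P" by (rule regular_module_module[OF assms(1)])
  have c: "?c \<in> module_hom A ?F ?G" by (rule matrix_map_module_hom[OF assms])
  have N: "LinearCombinations.submodule A N ?G"
    unfolding N_def by (rule module_hom_image_submodule[OF A.func_space_is_module A.func_space_is_module c])
  interpret Q: Module.module A "quotient_module ?G N" by (rule quotient_module_module(1)[OF N])
  let ?V = "{v i | v i. i < n \<and> v \<in> {..<n} \<rightarrow> carrier A \<and>
      (\<forall>j<m. (\<Oplus>\<^bsub>A\<^esub> i\<in>{..<n}. v i \<otimes>\<^bsub>A\<^esub> C $$ (i, j)) = \<zero>\<^bsub>A\<^esub>)}"
  let ?U = "\<Union>f\<in>module_hom A (quotient_module ?G N) ?P. f ` carrier (quotient_module ?G N)"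
  have V: "?V \<subseteq> carrier A" by auto
  have U: "?U \<subseteq> carrier A"
    using module_hom_closed[of _ A _ ?P] by (auto simp: regular_module_simps Pi_iff)
  have col: "?c (unit_fun A m j) = (\<lambda>i\<in>{..<n}. C $$ (i, j))" if "j < m" for j
    by (rule matrix_map_unit_fun[OF assms that])
  have form_col: "f (?c (unit_fun A m j)) = (\<Oplus>\<^bsub>A\<^esub> i\<in>{..<n}. f (unit_fun A n i) \<otimes>\<^bsub>A\<^esub> C $$ (i, j))"
    if f: "f \<in> module_hom A ?G ?P" and j: "j < m" for f j
  proof -
    have fe: "f (unit_fun A n i) \<in> carrier A" for i
      using module_hom_closed[OF f] unit_fun_carrier[OF assms(1)] by (auto simp: regular_module_simps)
    have "f (?c (unit_fun A m j)) =
        (\<Oplus>\<^bsub>A\<^esub> i\<in>{..<n}. ?c (unit_fun A m j) i \<otimes>\<^bsub>A\<^esub> f (unit_fun A n i))"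
      using module_hom_closed[OF c] unit_fun_carrier[OF assms(1)]
      by (intro free_space_form_eq[OF assms(1) f]) auto
    also have "\<dots> = (\<Oplus>\<^bsub>A\<^esub> i\<in>{..<n}. f (unit_fun A n i) \<otimes>\<^bsub>A\<^esub> C $$ (i, j))"
      using fe assms(3) j by (intro A.finsum_cong') (auto simp: col A.m_comm)
    finally show ?thesis .
  qed
  have VU: "?V \<subseteq> ?U"
  proof
    fix y assume "y \<in> ?V"
    then obtain v k where k: "k < n" "y = v k" and v: "v \<in> {..<n} \<rightarrow> carrier A"
      and v0: "\<And>j. j < m \<Longrightarrow> (\<Oplus>\<^bsub>A\<^esub> i\<in>{..<n}. v i \<otimes>\<^bsub>A\<^esub> C $$ (i, j)) = \<zero>\<^bsub>A\<^esub>" by auto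
    define h where "h w = (\<Oplus>\<^bsub>A\<^esub> i\<in>{..<n}. v i \<otimes>\<^bsub>A\<^esub> w i)" for w
    have h: "h \<in> module_hom A ?G ?P" unfolding h_def by (rule row_form_hom[OF assms(1) v])
    have he: "h (unit_fun A n i) = v i" if "i < n" for i
    proof -
      have "h (unit_fun A n i) = (\<Oplus>\<^bsub>A\<^esub> l\<in>{..<n}. if i = l then v l else \<zero>\<^bsub>A\<^esub>)"
        unfolding h_def using v by (intro A.finsum_cong') (auto simp: unit_fun_def Pi_iff)
      also have "\<dots> = v i" using that v by (intro A.finsum_singleton) auto
      finally show ?thesis .
    qed
    have h0: "h (?c (unit_fun A m j)) = \<zero>\<^bsub>A\<^esub>" if j: "j < m" for j
    proof -
      have "h (?c (unit_fun A m j)) = (\<Oplus>\<^bsub>A\<^esub> i\<in>{..<n}. v i \<otimes>\<^bsub>A\<^esub> C $$ (i, j))"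
        unfolding form_col[OF h j] using v assms(3) j by (intro A.finsum_cong') (auto simp: he Pi_iff)
      then show ?thesis using v0[OF j] by simp
    qed
    \<comment> \<open>The composite \<open>h \<circ> ?c\<close> is again a linear form and vanishes on the basis, hence everywhere.\<close>
    have "h x = \<zero>\<^bsub>?P\<^esub>" if "x \<in> N" for x
    proof -
      from that obtain w where w: "w \<in> carrier ?F" "x = ?c w" unfolding N_def by auto
      then have wj: "w j \<in> carrier A" if "j < m" for j
        using that by (auto simp: free_space_carrier[OF A.ring_axioms])
      have "h (?c w) = (\<Oplus>\<^bsub>A\<^esub> j\<in>{..<m}. w j \<otimes>\<^bsub>A\<^esub> h (?c (unit_fun A m j)))"
        by (rule free_space_form_eq[OF assms(1) module_hom_comp[OF c h] w(1)])
      also have "\<dots> = \<zero>\<^bsub>A\<^esub>" using wj by (intro A.add.finprod_one_eqI) (auto simp: h0)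
      finally show ?thesis using w by (simp add: regular_module_simps)
    qed
    from quotient_module_hom_lift[OF N P h this] obtain f where
      f: "f \<in> module_hom A (quotient_module ?G N) ?P" "\<And>x. x \<in> carrier ?G \<Longrightarrow> f (N +>\<^bsub>?G\<^esub> x) = h x"
      by blast
    have "y = f (N +>\<^bsub>?G\<^esub> unit_fun A n k)"
      using f(2)[OF unit_fun_carrier[OF assms(1)]] he k by simp
    moreover have "N +>\<^bsub>?G\<^esub> unit_fun A n k \<in> carrier (quotient_module ?G N)"
      using unit_fun_carrier[OF assms(1)] by (auto simp: quotient_module_carrier)
    ultimately show "y \<in> ?U" using f(1) by blast
  qed
  have UV: "?U \<subseteq> Idl\<^bsub>A\<^esub> ?V"
  proof
    interpret J: ideal "Idl\<^bsub>A\<^esub> ?V" A by (rule A.genideal_ideal[OF V])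
    fix y assume "y \<in> ?U"
    then obtain f w where f: "f \<in> module_hom A (quotient_module ?G N) ?P"
      and w: "w \<in> carrier ?G" "y = f (N +>\<^bsub>?G\<^esub> w)" by (auto simp: quotient_module_carrier)
    define h where "h x = f (N +>\<^bsub>?G\<^esub> x)" for x
    have h: "h \<in> module_hom A ?G ?P"
      unfolding h_def by (rule module_hom_comp[OF quotient_module_proj_hom[OF N] f])
    interpret f: mod_hom A "quotient_module ?G N" ?P f
      using f P Q.module_axioms by (simp add: mod_hom_def mod_hom_axioms_def)
    have he: "h (unit_fun A n i) \<in> carrier A" for i
      using module_hom_closed[OF h] unit_fun_carrier[OF assms(1)] by (auto simp: regular_module_simps)
    have h0: "h (?c (unit_fun A m j)) = \<zero>\<^bsub>A\<^esub>" for j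
    proof -
      interpret N': abelian_subgroup N ?G by (rule submodule_abelian_subgroup[OF N])
      have "?c (unit_fun A m j) \<in> N" using unit_fun_carrier[OF assms(1)] by (auto simp: N_def)
      then have "N +>\<^bsub>?G\<^esub> ?c (unit_fun A m j) = \<zero>\<^bsub>quotient_module ?G N\<^esub>"
        by (simp add: N'.a_rcos_const quotient_module_def)
      then show ?thesis using f.f0_is_0 by (simp add: h_def regular_module_simps)
    qed
    have gen: "h (unit_fun A n i) \<in> Idl\<^bsub>A\<^esub> ?V" if "i < n" for i
    proof -
      have "h (unit_fun A n i) \<in> ?V"
        using that he form_col[OF h] h0 by (intro CollectI exI[of _ "\<lambda>i. h (unit_fun A n i)"] exI[of _ i]) auto
      then show ?thesis using A.genideal_self[OF V] by blast
    qed
    have wi: "w i \<in> carrier A" if "i < n" for i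
      using w that by (auto simp: free_space_carrier[OF A.ring_axioms])
    have "y = (\<Oplus>\<^bsub>A\<^esub> i\<in>{..<n}. w i \<otimes>\<^bsub>A\<^esub> h (unit_fun A n i))"
      using free_space_form_eq[OF assms(1) h w(1)] w(2) by (simp add: h_def)
    also have "\<dots> \<in> Idl\<^bsub>A\<^esub> ?V"
      using gen wi by (intro ideal_finsum_closed[OF J.is_ideal]) (auto intro: J.I_l_closed)
    finally show "y \<in> Idl\<^bsub>A\<^esub> ?V" .
  qed
  have "Idl\<^bsub>A\<^esub> ?U = Idl\<^bsub>A\<^esub> ?V"
  proof (rule subset_antisym)
    show "Idl\<^bsub>A\<^esub> ?U \<subseteq> Idl\<^bsub>A\<^esub> ?V"
      by (rule A.genideal_minimal[OF A.genideal_ideal[OF V] UV])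
    show "Idl\<^bsub>A\<^esub> ?V \<subseteq> Idl\<^bsub>A\<^esub> ?U"
      by (rule A.genideal_minimal[OF A.genideal_ideal[OF U]
            subset_trans[OF VU A.genideal_self[OF U]]])
  qed
  then show ?thesis
    unfolding cokernel_def N_def[symmetric] trace_ideal_eq_genideal[OF Q.module_axioms] .
qed

text \<open>The rows that annihilate \<open>C\<close> modulo \<open>x\<close> are the combinations of the rows of \<open>B\<close> modulo \<open>x\<close>:
  from \<open>a C = x u\<close> follows \<open>x a = a C B = x (u B)\<close>, and \<open>x\<close> can be cancelled.\<close>

lemma trace_ideal_cokernel_matrix_factorization:
  fixes x :: "'b::comm_ring_1"
  assumes C: "C \<in> carrier_mat n n" and B: "B \<in> carrier_mat n n"
    and CB: "C * B = x \<cdot>\<^sub>m 1\<^sub>m n" and BC: "B * C = x \<cdot>\<^sub>m 1\<^sub>m n"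
    and nzd: "\<And>y. x * y = 0 \<Longrightarrow> y = 0"
  defines "I \<equiv> PIdl\<^bsub>class_ring\<^esub> x"
  defines "Q \<equiv> class_ring Quot I"
  defines "red \<equiv> map_mat (\<lambda>a. I +>\<^bsub>class_ring\<^esub> a)"
  shows "trace_ideal Q (cokernel (free_space Q n) (free_space Q n) (matrix_map Q (red C))) =
    Idl\<^bsub>Q\<^esub> (elements_mat (red B))"
proof -
  let ?A = "class_ring :: 'b ring"
  define h where "h = (\<lambda>a. I +>\<^bsub>?A\<^esub> a)"
  have A: "cring ?A" by (rule class_cring.cring_axioms)
  interpret I: ideal I ?A unfolding I_def by (rule cring.cgenideal_ideal[OF A]) simp
  interpret h: ring_hom_cring ?A Q h unfolding Q_def h_def by (rule I.rcos_ring_hom_cring[OF A])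
  have Q: "cring Q" ..
  have hc: "h a \<in> carrier Q" for a using h.hom_closed by simp
  have hsum: "h (\<Sum>i<n. a i * b i) = (\<Oplus>\<^bsub>Q\<^esub> i\<in>{..<n}. h (a i) \<otimes>\<^bsub>Q\<^esub> h (b i))" for a b
  proof -
    have "h (\<Oplus>\<^bsub>?A\<^esub> i\<in>{..<n}. a i * b i) = (\<Oplus>\<^bsub>Q\<^esub> i\<in>{..<n}. (h \<circ> (\<lambda>i. a i * b i)) i)"
      by (rule h.hom_finsum) simp
    also have "(h \<circ> (\<lambda>i. a i * b i)) = (\<lambda>i. h (a i) \<otimes>\<^bsub>Q\<^esub> h (b i))"
      using h.hom_mult by (auto simp: fun_eq_iff)
    finally show ?thesis by (simp add: class_ring_simps)
  qed
  have h0: "h a = \<zero>\<^bsub>Q\<^esub> \<longleftrightarrow> x dvd a" for a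
  proof -
    have "h a = \<zero>\<^bsub>Q\<^esub> \<longleftrightarrow> a \<in> I"
      using I.rcos_const_imp_mem[of a] ring.a_rcos_zero[OF cring.axioms(1)[OF A] I.is_ideal] by (auto simp: h_def Q_def FactRing_def)
    then show ?thesis by (auto simp: I_def cgenideal_def dvd_def mult.commute)
  qed
  have h_surj: "\<exists>a. q = h a" if "q \<in> carrier Q" for q
    using that by (auto simp: Q_def h_def FactRing_def A_RCOSETS_def')
  have redC: "red C \<in> carrier_mat n n" "\<And>i j. i < n \<Longrightarrow> j < n \<Longrightarrow> red C $$ (i, j) = h (C $$ (i, j))"
    and redB: "red B \<in> carrier_mat n n" "\<And>i j. i < n \<Longrightarrow> j < n \<Longrightarrow> red B $$ (i, j) = h (B $$ (i, j))"
    using C B by (auto simp: red_def h_def)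
  let ?V = "{v i | v i. i < n \<and> v \<in> {..<n} \<rightarrow> carrier Q \<and>
      (\<forall>j<n. (\<Oplus>\<^bsub>Q\<^esub> i\<in>{..<n}. v i \<otimes>\<^bsub>Q\<^esub> red C $$ (i, j)) = \<zero>\<^bsub>Q\<^esub>)}"
  let ?E = "elements_mat (red B)"
  have V: "?V \<subseteq> carrier Q" by auto
  have E: "?E \<subseteq> carrier Q" using redB hc by (auto dest!: elements_matD)
  have prod: "(\<Sum>i<n. D $$ (k, i) * D' $$ (i, j)) = (if k = j then x else 0)"
    if "D \<in> carrier_mat n n" "D' \<in> carrier_mat n n" "D * D' = x \<cdot>\<^sub>m 1\<^sub>m n" "k < n" "j < n" for D D' k j
  proof -
    have "(\<Sum>i<n. D $$ (k, i) * D' $$ (i, j)) = (D * D') $$ (k, j)"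
      using that(1,2,4,5) by (auto simp: scalar_prod_def lessThan_atLeast0 intro!: sum.cong)
    then show ?thesis using that by simp
  qed
  have EV: "?E \<subseteq> ?V"
  proof
    fix y assume "y \<in> ?E"
    then obtain k l where kl: "k < n" "l < n" "y = h (B $$ (k, l))"
      using redB by (auto dest!: elements_matD)
    have "(\<Oplus>\<^bsub>Q\<^esub> i\<in>{..<n}. h (B $$ (k, i)) \<otimes>\<^bsub>Q\<^esub> red C $$ (i, j)) = \<zero>\<^bsub>Q\<^esub>" if j: "j < n" for j
    proof -
      have "(\<Oplus>\<^bsub>Q\<^esub> i\<in>{..<n}. h (B $$ (k, i)) \<otimes>\<^bsub>Q\<^esub> red C $$ (i, j)) =
          (\<Oplus>\<^bsub>Q\<^esub> i\<in>{..<n}. h (B $$ (k, i)) \<otimes>\<^bsub>Q\<^esub> h (C $$ (i, j)))"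
        using hc j by (intro h.S.finsum_cong') (auto simp: redC(2))
      also have "\<dots> = h (if k = j then x else 0)"
        unfolding hsum[symmetric] prod[OF B C BC kl(1) j] ..
      also have "\<dots> = \<zero>\<^bsub>Q\<^esub>" unfolding h0 by simp
      finally show ?thesis .
    qed
    then show "y \<in> ?V"
      using kl hc by (intro CollectI exI[of _ "\<lambda>i. h (B $$ (k, i))"] exI[of _ l]) auto
  qed
  have VE: "?V \<subseteq> Idl\<^bsub>Q\<^esub> ?E"
  proof
    interpret J: ideal "Idl\<^bsub>Q\<^esub> ?E" Q by (rule h.S.genideal_ideal[OF E])
    fix y assume "y \<in> ?V"
    then obtain v k where k: "k < n" "y = v k" and v: "v \<in> {..<n} \<rightarrow> carrier Q"
      and v0: "\<And>j. j < n \<Longrightarrow> (\<Oplus>\<^bsub>Q\<^esub> i\<in>{..<n}. v i \<otimes>\<^bsub>Q\<^esub> red C $$ (i, j)) = \<zero>\<^bsub>Q\<^esub>" by auto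
    have "\<forall>i. \<exists>a. i < n \<longrightarrow> v i = h a" using v h_surj by auto
    then obtain a where a: "\<And>i. i < n \<Longrightarrow> v i = h (a i)" by metis
    have "x dvd (\<Sum>i<n. a i * C $$ (i, j))" if j: "j < n" for j
    proof -
      have "h (\<Sum>i<n. a i * C $$ (i, j)) = (\<Oplus>\<^bsub>Q\<^esub> i\<in>{..<n}. v i \<otimes>\<^bsub>Q\<^esub> red C $$ (i, j))"
        unfolding hsum using hc j v by (intro h.S.finsum_cong') (auto simp: redC(2) a)
      then show ?thesis using v0[OF j] h0 by simp
    qed
    then have "\<forall>j. \<exists>u. j < n \<longrightarrow> (\<Sum>i<n. a i * C $$ (i, j)) = x * u" by (auto simp: dvd_def)
    then obtain u where u: "\<And>j. j < n \<Longrightarrow> (\<Sum>i<n. a i * C $$ (i, j)) = x * u j" by metis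
    \<comment> \<open>The next chain is \<open>x a = a (C B) = (a C) B = x (u B)\<close>, read off in column \<open>k\<close>.\<close>
    have "x * a k = (\<Sum>i<n. a i * (if i = k then x else 0))"
      using k(1) by (simp add: if_distrib[of "(*) _"] sum.delta mult.commute cong: if_cong)
    also have "\<dots> = (\<Sum>i<n. a i * (\<Sum>j<n. C $$ (i, j) * B $$ (j, k)))"
      using k(1) by (intro sum.cong refl) (simp add: prod[OF C B CB])
    also have "\<dots> = (\<Sum>i<n. \<Sum>j<n. a i * C $$ (i, j) * B $$ (j, k))"
      by (simp add: sum_distrib_left mult.assoc)
    also have "\<dots> = (\<Sum>j<n. (\<Sum>i<n. a i * C $$ (i, j)) * B $$ (j, k))"
      by (subst sum.swap) (simp add: sum_distrib_right)
    also have "\<dots> = (\<Sum>j<n. x * u j * B $$ (j, k))"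
      by (intro sum.cong refl) (simp add: u)
    also have "\<dots> = x * (\<Sum>j<n. u j * B $$ (j, k))"
      by (simp add: sum_distrib_left mult.assoc)
    finally have "x * (a k - (\<Sum>j<n. u j * B $$ (j, k))) = 0" by (simp add: right_diff_distrib)
    then have "a k = (\<Sum>j<n. u j * B $$ (j, k))" using nzd by fastforce
    then have "y = (\<Oplus>\<^bsub>Q\<^esub> j\<in>{..<n}. h (u j) \<otimes>\<^bsub>Q\<^esub> h (B $$ (j, k)))"
      using k a hsum by simp
    also have "\<dots> \<in> Idl\<^bsub>Q\<^esub> ?E"
    proof (rule ideal_finsum_closed[OF J.is_ideal])
      fix j assume "j \<in> {..<n}"
      then have "h (B $$ (j, k)) \<in> ?E" using redB k(1) by (intro elements_matI[of _ n n j k]) auto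
      then show "h (u j) \<otimes>\<^bsub>Q\<^esub> h (B $$ (j, k)) \<in> Idl\<^bsub>Q\<^esub> ?E"
        using h.S.genideal_self[OF E] hc by (auto intro: J.I_l_closed)
    qed simp
    finally show "y \<in> Idl\<^bsub>Q\<^esub> ?E" .
  qed
  have "Idl\<^bsub>Q\<^esub> ?V = Idl\<^bsub>Q\<^esub> ?E"
  proof (rule subset_antisym)
    show "Idl\<^bsub>Q\<^esub> ?V \<subseteq> Idl\<^bsub>Q\<^esub> ?E"
      by (rule h.S.genideal_minimal[OF h.S.genideal_ideal[OF E] VE])
    show "Idl\<^bsub>Q\<^esub> ?E \<subseteq> Idl\<^bsub>Q\<^esub> ?V"
      by (rule h.S.genideal_minimal[OF h.S.genideal_ideal[OF V]
            subset_trans[OF EV h.S.genideal_self[OF V]]])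
  qed
  moreover have "red C $$ (i, j) \<in> carrier Q" if "i < n" "j < n" for i j
    using redC(2)[OF that] hc by simp
  ultimately show ?thesis using trace_ideal_cokernel[OF Q redC(1)] by metis
qed

section \<open>The element \<open>z\<^sup>2 + g\<close> is a nonzerodivisor\<close>

text \<open>The principal ideals of the \<open>a j\<close> ascend, so \<open>a (N + 1) = r * a N = r * c * a (N + 1)\<close> for some
  \<open>N\<close> and \<open>r\<close>, and \<open>a (N + 1)\<close> reproduces itself under every power of \<open>r * c\<close>. On the other hand
  \<open>c * a 0 = 0\<close> means that \<open>c ^ (N + 2)\<close> kills \<open>a (N + 1)\<close>.\<close>

lemma noetherian_divisible_chain_zero:
  fixes a :: "nat \<Rightarrow> 'a::comm_ring_1"
  assumes noeth: "noetherian_ring (class_ring :: 'a ring)"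
    and step: "\<And>j. a j = c * a (Suc j)" and a0: "c * a 0 = 0"
  shows "a 0 = 0"
proof -
  interpret noetherian_ring "class_ring :: 'a ring" by (rule noeth)
  let ?J = "\<lambda>j. PIdl\<^bsub>class_ring\<^esub> (a j)"
  have mem: "y \<in> ?J j \<longleftrightarrow> a j dvd y" for y j
    by (auto simp: cgenideal_def dvd_def mult.commute)
  have "a (j + k) dvd a j" for j k
  proof (induction k)
    case (Suc k)
    then show ?case using step[of "j + k"] by (metis add_Suc_right dvd_mult_left dvd_refl dvd_trans dvd_triv_right)
  qed simp
  then have mono: "?J j \<subseteq> ?J k" if "j \<le> k" for j k
    using that by (auto simp: mem) (metis dvd_trans le_Suc_ex)
  moreover have "ideal (?J j) class_ring" for j
    by (rule cring.cgenideal_ideal[OF class_cring.cring_axioms]) simp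
  moreover have "?J j \<subseteq> ?J k \<or> ?J k \<subseteq> ?J j" for j k
    using mono linear[of j k] by metis
  ultimately have "subset.chain {J. ideal J class_ring} (range ?J)"
    unfolding subset.chain_def by fast
  then have "\<Union>(range ?J) \<in> range ?J" by (intro ideal_chain_is_trivial) auto
  then obtain N where "\<Union>(range ?J) = ?J N" by auto
  then have "a (Suc N) \<in> ?J N" using mem[of "a (Suc N)" "Suc N"] by auto
  then obtain r where "a (Suc N) = a N * r" unfolding mem by (elim dvdE)
  then have b: "a (Suc N) = (r * c) * a (Suc N)" using step[of N] by (simp add: mult_ac)
  have b_pow: "a (Suc N) = (r * c) ^ m * a (Suc N)" for m
  proof (induction m)
    case (Suc m)
    have "(r * c) ^ Suc m * a (Suc N) = (r * c) ^ m * ((r * c) * a (Suc N))" by (simp add: mult_ac)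
    then show ?case using Suc b by simp
  qed simp
  have a0_eq: "a 0 = c ^ j * a j" for j
  proof (induction j)
    case (Suc j)
    then show ?case using step[of j] by (simp add: mult_ac)
  qed simp
  have "c ^ Suc (Suc N) * a (Suc N) = 0" using a0 a0_eq[of "Suc N"] by (simp add: mult_ac)
  then have "a (Suc N) = 0"
    using b_pow[of "Suc (Suc N)"] unfolding power_mult_distrib by (metis mult.assoc mult_zero_right)
  then show ?thesis using a0_eq[of "Suc N"] by simp
qed

text \<open>Comparing coefficients in \<open>(z\<^sup>2 + g) * f = 0\<close> gives \<open>f\<^sub>k = -g * f\<^sub>k\<^sub>+\<^sub>2\<close> for all \<open>k\<close>, so the
  coefficients \<open>f\<^sub>k, f\<^sub>k\<^sub>+\<^sub>2, \<dots>\<close> form a chain as in the previous lemma. The condition on its first term,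
  \<open>g * f\<^sub>k = 0\<close>, holds outright for \<open>k < 2\<close>, and otherwise because \<open>f\<^sub>k\<^sub>-\<^sub>2 = 0\<close> by induction.\<close>

lemma X2_plus_const_nonzerodivisor:
  fixes g :: "'a::comm_ring_1"
  assumes noeth: "noetherian_ring (class_ring :: 'a ring)"
    and f: "(fps_X ^ 2 + fps_const g) * f = 0"
  shows "f = 0"
proof -
  have coeff: "(if k < 2 then 0 else fps_nth f (k - 2)) + g * fps_nth f k = 0" for k
  proof -
    have "fps_nth ((fps_X ^ 2 + fps_const g) * f) k = 0" using f by simp
    then show ?thesis by (simp add: distrib_right fps_X_power_mult_nth)
  qed
  have "fps_nth f k = 0" for k
  proof (induction k rule: less_induct)
    case (less k)
    have "fps_nth f (k + 2 * 0) = 0"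
    proof (rule noetherian_divisible_chain_zero[OF noeth, where c = "- g"])
      show "fps_nth f (k + 2 * j) = - g * fps_nth f (k + 2 * Suc j)" for j
        using coeff[of "k + 2 * Suc j"] by (simp add: add_eq_0_iff2)
      show "- g * fps_nth f (k + 2 * 0) = 0"
        using coeff[of k] less.IH[of "k - 2"] by (simp split: if_splits)
    qed
    then show ?case by simp
  qed
  then show ?thesis by (simp add: fps_eq_iff)
qed

section \<open>The trace ideal over the hypersurface ring\<close>

theorem corollary4p7:
  fixes g :: "'a::comm_ring_1"
    and n :: nat
    and \<phi> :: "'a fps mat"
    and M :: "('a fps set, (nat \<Rightarrow> 'a fps set) set) module"
  assumes "noetherian_ring (class_ring :: 'a ring)"
    and "local_ring (class_ring :: 'a ring)"
    and "\<phi> \<in> carrier_mat n n"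
    and "elements_mat \<phi> \<subseteq> range fps_const"
    and "matrix_factorization power_series_ring (fps_X ^ 2 + fps_const g)
           (free_space power_series_ring n) (free_space power_series_ring n)
           (matrix_map power_series_ring (fps_X \<cdot>\<^sub>m 1\<^sub>m n - \<phi>))
           (matrix_map power_series_ring (fps_X \<cdot>\<^sub>m 1\<^sub>m n + \<phi>))"
    and "M = cokernel (free_space (hypersurface_ring g) n) (free_space (hypersurface_ring g) n)
               (matrix_map (hypersurface_ring g) (reduce_mat g (fps_X \<cdot>\<^sub>m 1\<^sub>m n - \<phi>)))"
  shows "trace_ideal (hypersurface_ring g) M =
           Idl\<^bsub>hypersurface_ring g\<^esub> (elements_mat (reduce_mat g (fps_X \<cdot>\<^sub>m 1\<^sub>m n + \<phi>)))"
proof -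
  have C: "fps_X \<cdot>\<^sub>m 1\<^sub>m n - \<phi> \<in> carrier_mat n n" and B: "fps_X \<cdot>\<^sub>m 1\<^sub>m n + \<phi> \<in> carrier_mat n n"
    using assms(3) by auto
  note mf = assms(5)[unfolded matrix_factorization_iff_mat[OF C B]]
  show ?thesis
    unfolding assms(6) hypersurface_ring_def reduce_mat_def hypersurface_ideal_def
    using mf X2_plus_const_nonzerodivisor[OF assms(1)]
    by (intro trace_ideal_cokernel_matrix_factorization[OF C B]) auto
qed

end
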